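(* Let $T$ be a bounded operator on a complex Hilbert space. Then $T$ is an invertible contraction if and only if $\overline{\mathbb{D}}\setminus\{0\}$ is a von Neumann set for $T$.
   Context: $\overline{\mathbb{D}}$ is the closed unit disk in $\mathbb{C}$. A contraction is an operator of norm at most $1$. A set $Y\subseteq\mathbb{C}$ (not necessarily compact or closed) is a von Neumann set for $T$ if $\sigma(T)\subseteq Y$ and $\|f(T)\|\le\|f\|_{\infty,Y}:=\sup_{\xi\in Y}|f(\xi)|$ (allowed to be $+\infty$) for every $f\in Rat(Y)$, where $Rat(Y)$ is the algebra of rational functions $f=p/g$ with $p,g$ polynomials and $g$ having no zeros in $Y$, and $f(T)=p(T)g(T)^{-1}$. *)

theory Defs
  imports
    "HOL-Analysis.Analysis"
    "HOL-Computational_Algebra.Polynomial"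
begin

text \<open>The library has only real inner product spaces. A complex Hilbert space is modelled here as
  a complete normed space whose norm is induced by a sesquilinear form, linear in the first
  argument.\<close>

class complex_vector = real_vector +
  fixes scaleC :: "complex \<Rightarrow> 'a \<Rightarrow> 'a" (infixr "*\<^sub>C" 75)
  assumes scaleC_add_right: "c *\<^sub>C (x + y) = c *\<^sub>C x + c *\<^sub>C y"
    and scaleC_add_left: "(c + d) *\<^sub>C x = c *\<^sub>C x + d *\<^sub>C x"
    and scaleC_scaleC: "c *\<^sub>C d *\<^sub>C x = (c * d) *\<^sub>C x"
    and scaleC_one: "1 *\<^sub>C x = x"
    and scaleR_scaleC: "scaleR r x = complex_of_real r *\<^sub>C x"

class complex_inner = complex_vector + real_normed_vector +
  fixes cinner :: "'a \<Rightarrow> 'a \<Rightarrow> complex"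
  assumes cinner_commute: "cinner x y = cnj (cinner y x)"
    and cinner_add_left: "cinner (x + y) z = cinner x z + cinner y z"
    and cinner_scaleC_left: "cinner (c *\<^sub>C x) y = c * cinner x y"
    and cinner_ge_zero: "0 \<le> Re (cinner x x)"
    and cinner_eq_zero_iff: "cinner x x = 0 \<longleftrightarrow> x = 0"
    and norm_eq_sqrt_cinner: "norm x = sqrt (Re (cinner x x))"

class chilbert_space = complex_inner + complete_space

definition bounded_clinear :: "('a::complex_inner \<Rightarrow> 'b::complex_inner) \<Rightarrow> bool" where
  "bounded_clinear T \<longleftrightarrow> bounded_linear T \<and> (\<forall>c x. T (c *\<^sub>C x) = c *\<^sub>C T x)"

definition invertible_op :: "('a::complex_inner \<Rightarrow> 'a) \<Rightarrow> bool" where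
  "invertible_op T \<longleftrightarrow>
     bounded_clinear T \<and> (\<exists>S. bounded_clinear S \<and> S \<circ> T = id \<and> T \<circ> S = id)"

definition contraction :: "('a::complex_inner \<Rightarrow> 'a) \<Rightarrow> bool" where
  "contraction T \<longleftrightarrow> bounded_clinear T \<and> onorm T \<le> 1"

definition spectrum :: "('a::complex_inner \<Rightarrow> 'a) \<Rightarrow> complex set" where
  "spectrum T = {z. \<not> invertible_op (\<lambda>x. T x - z *\<^sub>C x)}"

definition poly_op :: "complex poly \<Rightarrow> ('a::complex_inner \<Rightarrow> 'a) \<Rightarrow> 'a \<Rightarrow> 'a" where
  "poly_op p T = (\<lambda>x. \<Sum>i\<le>degree p. coeff p i *\<^sub>C (T ^^ i) x)"

text \<open>A rational function \<open>f = p / g\<close> is represented by a pair \<open>(p, g)\<close>, not necessarily in lowest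
  terms. The condition \<open>g \<noteq> 0\<close> only matters for empty \<open>Y\<close>.\<close>

definition Rat :: "complex set \<Rightarrow> (complex poly \<times> complex poly) set" where
  "Rat Y = {(p, g). g \<noteq> 0 \<and> (\<forall>\<xi>\<in>Y. poly g \<xi> \<noteq> 0)}"

text \<open>Only used when \<open>g\<close> has no zeros in a set containing the spectrum of \<open>T\<close>; then \<open>g(T)\<close> is
  invertible, and \<open>inv\<close> is its genuine inverse.\<close>

definition rat_op :: "complex poly \<Rightarrow> complex poly \<Rightarrow> ('a::complex_inner \<Rightarrow> 'a) \<Rightarrow> 'a \<Rightarrow> 'a" where
  "rat_op p g T = poly_op p T \<circ> inv (poly_op g T)"

text \<open>The supremum norm over \<open>Y\<close> is taken in the extended nonnegative reals, so that it may be
  infinite.\<close>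

definition rat_sup_norm :: "complex set \<Rightarrow> complex poly \<Rightarrow> complex poly \<Rightarrow> ennreal" where
  "rat_sup_norm Y p g = (SUP \<xi>\<in>Y. ennreal (cmod (poly p \<xi> / poly g \<xi>)))"

definition von_Neumann_set :: "complex set \<Rightarrow> ('a::complex_inner \<Rightarrow> 'a) \<Rightarrow> bool" where
  "von_Neumann_set Y T \<longleftrightarrow>
     spectrum T \<subseteq> Y \<and>
     (\<forall>(p, g)\<in>Rat Y. ennreal (onorm (rat_op p g T)) \<le> rat_sup_norm Y p g)"

end

theory Submission
  imports
    Defs
    "HOL-Computational_Algebra.Fundamental_Theorem_Algebra"
    "HOL-Complex_Analysis.Conformal_Mappings"
begin

text \<open>The heart of the matter is that \<open>\<bar>p\<bar> \<le> \<bar>g\<bar>\<close> on the unit circle, with \<open>g\<close> zero-free on the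
  closed disc, implies \<open>\<parallel>p(T)x\<parallel> \<le> \<parallel>g(T)x\<parallel>\<close> for a contraction \<open>T\<close>. If \<open>q\<close> is a polynomial whose
  conjugate reflection \<open>q\<^sup>#\<close> is zero-free in the open disc, then \<open>q / q\<^sup>#\<close> is a finite Blaschke
  product, and \<open>\<parallel>q(T)x\<parallel> \<le> \<parallel>q\<^sup>#(T)x\<parallel>\<close> follows factor by factor from
  \<open>\<parallel>(T - a)y\<parallel> \<le> \<parallel>(1 - cnj a T)y\<parallel>\<close>. By the maximum principle this applies to
  \<open>q = \<plusminus>p + z\<^sup>m g\<^sup>#\<close>, with \<open>q\<^sup># = g \<plusminus> z\<^sup>m p\<^sup>#\<close>. Adding the squares for both signs, the parallelogram
  law gives \<open>\<parallel>p(T)x\<parallel>\<^sup>2 \<le> \<parallel>g(T)x\<parallel>\<^sup>2 + \<parallel>T\<^sup>m p\<^sup>#(T)x\<parallel>\<^sup>2\<close>; the last term tends to \<open>0\<close> if \<open>T\<close> is a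
  strict contraction, and \<open>rT\<close> with \<open>r \<longlonglongrightarrow> 1\<close> yields the general case. The puncture at \<open>0\<close> is
  harmless because a rational function that is bounded near \<open>0\<close> has no pole there.\<close>

section \<open>Complex inner product spaces\<close>

lemma scaleC_zero_right [simp]: "c *\<^sub>C (0::'a::complex_vector) = 0"
  using scaleC_add_right[of c 0 "0::'a"] by simp

lemma scaleC_zero_left [simp]: "0 *\<^sub>C (x::'a::complex_vector) = 0"
  using scaleC_add_left[of 0 0 x] by simp

lemma scaleC_minus_right: "c *\<^sub>C (- x::'a::complex_vector) = - (c *\<^sub>C x)"
  using scaleC_add_right[of c x "-x"] by (simp add: eq_neg_iff_add_eq_0 add.commute)

lemma scaleC_minus_left: "(- c) *\<^sub>C (x::'a::complex_vector) = - (c *\<^sub>C x)"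
  using scaleC_add_left[of c "-c" x] by (simp add: eq_neg_iff_add_eq_0 add.commute)

lemma scaleC_diff_right: "c *\<^sub>C (x - y::'a::complex_vector) = c *\<^sub>C x - c *\<^sub>C y"
  using scaleC_add_right[of c x "-y"] by (simp add: scaleC_minus_right)

lemma scaleC_scaleR_commute: "c *\<^sub>C (r *\<^sub>R (x::'a::complex_vector)) = r *\<^sub>R (c *\<^sub>C x)"
  by (simp add: scaleR_scaleC scaleC_scaleC mult.commute)

lemma norm_sq_cinner: "complex_of_real ((norm (x::'a::complex_inner))\<^sup>2) = cinner x x"
proof -
  have "Im (cinner x x) = 0"
    using arg_cong[OF cinner_commute[of x x], of Im] by simp
  then show ?thesis
    by (simp add: norm_eq_sqrt_cinner cinner_ge_zero complex_eq_iff)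
qed

lemma cinner_add_right: "cinner x (y + z) = cinner x y + cinner x (z::'a::complex_inner)"
  by (metis cinner_add_left cinner_commute complex_cnj_add)

lemma cinner_scaleC_right: "cinner x (c *\<^sub>C y) = cnj c * cinner x (y::'a::complex_inner)"
  by (metis cinner_scaleC_left cinner_commute complex_cnj_mult)

lemma norm_scaleC: "norm (c *\<^sub>C (x::'a::complex_inner)) = cmod c * norm x"
proof -
  have "complex_of_real ((norm (c *\<^sub>C x))\<^sup>2) = (c * cnj c) * cinner x x"
    by (simp only: norm_sq_cinner cinner_scaleC_left cinner_scaleC_right) (simp add: ac_simps)
  also have "\<dots> = complex_of_real ((cmod c * norm x)\<^sup>2)"
    by (simp only: complex_norm_square[symmetric] norm_sq_cinner[symmetric] power_mult_distrib of_real_mult)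
  finally have "(norm (c *\<^sub>C x))\<^sup>2 = (cmod c * norm x)\<^sup>2"
    using of_real_eq_iff by blast
  then show ?thesis
    by (simp add: power2_eq_iff_nonneg)
qed

text \<open>The scalar is kept general because several values are used: \<open>c = 1\<close> and
  \<open>c = -1\<close> for the parallelogram law, \<open>c = - a\<close> and
  \<open>c = - cnj a\<close> for comparing Moebius factors.\<close>

lemma norm_add_scaleC_sq:
  "(norm (x + c *\<^sub>C (y::'a::complex_inner)))\<^sup>2
     = (norm x)\<^sup>2 + (cmod c)\<^sup>2 * (norm y)\<^sup>2 + 2 * Re (c * cinner y x)"
proof -
  have "complex_of_real ((norm (x + c *\<^sub>C y))\<^sup>2)
      = cinner x x + cinner (c *\<^sub>C y) (c *\<^sub>C y) + (c * cinner y x + cnj (c * cinner y x))"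
    by (simp only: norm_sq_cinner cinner_add_left cinner_add_right cinner_scaleC_left
        cinner_scaleC_right complex_cnj_mult cinner_commute[of x y])
      (simp add: algebra_simps)
  also have "\<dots> = complex_of_real ((norm x)\<^sup>2 + (norm (c *\<^sub>C y))\<^sup>2 + 2 * Re (c * cinner y x))"
    by (simp only: norm_sq_cinner[symmetric] complex_add_cnj of_real_add)
  finally have "(norm (x + c *\<^sub>C y))\<^sup>2
      = (norm x)\<^sup>2 + (norm (c *\<^sub>C y))\<^sup>2 + 2 * Re (c * cinner y x)"
    using of_real_eq_iff by blast
  then show ?thesis
    by (simp add: norm_scaleC power_mult_distrib)
qed

lemma parallelogram:
  "(norm (x + y))\<^sup>2 + (norm (x - y))\<^sup>2 = 2 * (norm x)\<^sup>2 + 2 * (norm (y::'a::complex_inner))\<^sup>2"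
  using norm_add_scaleC_sq[of x 1 y] norm_add_scaleC_sq[of x "-1" y]
  by (simp add: scaleC_one scaleC_minus_left)

section \<open>Polynomials in an operator\<close>

lemma bounded_clinearD:
  assumes "bounded_clinear T"
  shows "bounded_linear T" "T (c *\<^sub>C x) = c *\<^sub>C T x"
  using assms by (auto simp: bounded_clinear_def)

text \<open>Padding with zero coefficients allows polynomials of different degrees to be summed over
  one range.\<close>

lemma poly_op_eq_sum:
  assumes "degree p \<le> n"
  shows "poly_op p T x = (\<Sum>i\<le>n. coeff p i *\<^sub>C (T ^^ i) x)"
  unfolding poly_op_def
  by (rule sum.mono_neutral_left) (use assms in \<open>auto simp: coeff_eq_0\<close>)

lemma poly_op_0 [simp]: "poly_op 0 T x = 0"
  by (simp add: poly_op_def)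

lemma poly_op_pCons:
  assumes "bounded_clinear T"
  shows "poly_op (pCons a p) T x = a *\<^sub>C x + T (poly_op p T x)"
proof -
  have "poly_op (pCons a p) T x = (\<Sum>i\<le>Suc (degree p). coeff (pCons a p) i *\<^sub>C (T ^^ i) x)"
    by (rule poly_op_eq_sum) (simp add: degree_pCons_le)
  also have "\<dots> = a *\<^sub>C x + (\<Sum>i\<le>degree p. T (coeff p i *\<^sub>C (T ^^ i) x))"
    by (simp add: sum.atMost_Suc_shift bounded_clinearD(2)[OF assms] del: sum.atMost_Suc)
  also have "(\<Sum>i\<le>degree p. T (coeff p i *\<^sub>C (T ^^ i) x)) = T (poly_op p T x)"
    by (simp add: poly_op_def linear_sum bounded_linear.linear[OF bounded_clinearD(1)[OF assms]])
  finally show ?thesis .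
qed

lemma poly_op_add: "poly_op (p + q) T x = poly_op p T x + poly_op q T x"
proof -
  define n where "n = max (degree p) (degree q)"
  have "degree (p + q) \<le> n" "degree p \<le> n" "degree q \<le> n"
    by (auto simp: n_def degree_add_le)
  then show ?thesis
    by (simp add: poly_op_eq_sum[where n = n] scaleC_add_left sum.distrib)
qed

lemma poly_op_smult:
  assumes "bounded_clinear T"
  shows "poly_op (smult c p) T x = c *\<^sub>C poly_op p T x"
  by (induction p)
    (simp_all add: poly_op_pCons[OF assms] bounded_clinearD(2)[OF assms] scaleC_add_right scaleC_scaleC)

lemma poly_op_mult:
  assumes "bounded_clinear T"
  shows "poly_op (p * q) T x = poly_op p T (poly_op q T x)"
proof (induction p)
  case (pCons a p)
  then show ?case
    by (simp add: poly_op_add poly_op_smult[OF assms] poly_op_pCons[OF assms])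
qed simp

lemma poly_op_monom_one:
  assumes "bounded_clinear T"
  shows "poly_op (monom 1 n) T x = (T ^^ n) x"
  by (induction n)
    (simp_all add: poly_op_pCons[OF assms] monom_0 monom_Suc scaleC_one
      linear_0[OF bounded_linear.linear[OF bounded_clinearD(1)[OF assms]]])

lemma poly_op_linear_poly:
  assumes "bounded_clinear T"
  shows "poly_op [:a, b:] T x = a *\<^sub>C x + b *\<^sub>C T x"
  by (simp add: poly_op_pCons[OF assms] bounded_clinearD(2)[OF assms]
      linear_0[OF bounded_linear.linear[OF bounded_clinearD(1)[OF assms]]])

section \<open>Real multiples of the operator\<close>

lemma bounded_clinear_scaleR:
  assumes "bounded_clinear T"
  shows "bounded_clinear (\<lambda>x. r *\<^sub>R T x)"
  using assms
  by (auto simp: bounded_clinear_def scaleC_scaleR_commute intro!: bounded_linear_intros)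

lemma tendsto_poly_op_scaleR:
  assumes T: "bounded_clinear T" and r: "(r \<longlongrightarrow> (1::real)) F"
  shows "((\<lambda>n. poly_op p (\<lambda>x. r n *\<^sub>R T x) x) \<longlongrightarrow> poly_op p T x) F"
proof (induction p)
  case (pCons a p)
  have "((\<lambda>n. a *\<^sub>C x + r n *\<^sub>R T (poly_op p (\<lambda>x. r n *\<^sub>R T x) x))
      \<longlongrightarrow> a *\<^sub>C x + 1 *\<^sub>R T (poly_op p T x)) F"
    by (intro tendsto_intros r bounded_linear.tendsto[OF bounded_clinearD(1)[OF T]] pCons.IH)
  then show ?case
    by (simp add: poly_op_pCons[OF T] poly_op_pCons[OF bounded_clinear_scaleR[OF T]])
qed simp

section \<open>Conjugate reflection of polynomials\<close>

text \<open>This is \<open>q\<^sup>#(z) = z\<^sup>n * cnj (q (1 / cnj z))\<close>, whose modulus on the unit circle is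
  that of \<open>q\<close>; the degree bound \<open>n\<close> need not be attained.\<close>

definition conj_reflect :: "nat \<Rightarrow> complex poly \<Rightarrow> complex poly" where
  "conj_reflect n q = (\<Sum>i\<le>n. monom (cnj (coeff q i)) (n - i))"

lemma poly_eq_sum:
  fixes p :: "'a::comm_semiring_1 poly"
  assumes "degree p \<le> n"
  shows "poly p x = (\<Sum>i\<le>n. coeff p i * x ^ i)"
  unfolding poly_altdef
  by (rule sum.mono_neutral_left) (use assms in \<open>auto simp: coeff_eq_0\<close>)

lemma degree_conj_reflect: "degree (conj_reflect n q) \<le> n"
  unfolding conj_reflect_def
  by (rule degree_sum_le) (auto intro: order_trans[OF degree_monom_le])

lemma poly_conj_reflect:
  assumes "degree q \<le> n" "z \<noteq> 0"
  shows "poly (conj_reflect n q) z = z ^ n * cnj (poly q (1 / cnj z))"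
proof -
  have "poly (conj_reflect n q) z = (\<Sum>i\<le>n. cnj (coeff q i) * z ^ (n - i))"
    by (simp add: conj_reflect_def poly_sum poly_monom)
  also have "\<dots> = (\<Sum>i\<le>n. z ^ n * (cnj (coeff q i) * (1 / z) ^ i))"
    using assms(2) by (intro sum.cong) (auto simp: power_diff power_divide field_simps)
  also have "\<dots> = z ^ n * cnj (poly q (1 / cnj z))"
    by (simp add: poly_eq_sum[OF assms(1)] sum_distrib_left)
  finally show ?thesis .
qed

lemma conj_reflect_unique:
  assumes "degree q \<le> n" "\<And>z. z \<noteq> 0 \<Longrightarrow> poly p z = z ^ n * cnj (poly q (1 / cnj z))"
  shows "conj_reflect n q = p"
proof -
  \<comment> \<open>The extra factor \<open>z\<close> makes the product vanish at 0 as well, where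
    the assumed identity gives no information.\<close>
  have "poly (monom 1 1 * (conj_reflect n q - p)) z = 0" for z
    by (cases "z = 0") (simp_all add: poly_monom poly_conj_reflect assms)
  then have "monom 1 1 * (conj_reflect n q - p) = 0"
    using poly_all_0_iff_0 by blast
  then show ?thesis
    by simp
qed

text \<open>One of the \<open>Suc n\<close> factors \<open>z\<close> goes to the linear term:
  \<open>z * cnj (1 / cnj z - a) = 1 - cnj a * z\<close>.\<close>

lemma conj_reflect_linear_mult:
  assumes "degree q \<le> n"
  shows "conj_reflect (Suc n) ([:- a, 1:] * q) = [:1, - cnj a:] * conj_reflect n q"
proof (rule conj_reflect_unique)
  show "degree ([:- a, 1:] * q) \<le> Suc n"
    using degree_mult_le[of "[:- a, 1:]" q] assms by simp
qed (simp add: poly_conj_reflect assms field_simps)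

lemma norm_poly_conj_reflect_circle:
  assumes "degree q \<le> n" "cmod z = 1"
  shows "cmod (poly (conj_reflect n q) z) = cmod (poly q z)"
proof -
  have "z \<noteq> 0" using assms(2) by auto
  moreover have "1 / cnj z = z"
    using assms(2) complex_norm_square[of z] \<open>z \<noteq> 0\<close> by (simp add: field_simps)
  ultimately show ?thesis
    using assms by (simp add: poly_conj_reflect norm_mult norm_power)
qed

section \<open>The von Neumann inequality\<close>

text \<open>The cross terms in the two expansions agree, so the difference of the squares factors
  into two nonnegative terms.\<close>

lemma norm_Moebius_le:
  fixes T :: "'a::complex_inner \<Rightarrow> 'a"
  assumes "norm (T y) \<le> norm y" "cmod a \<le> 1"
  shows "norm (T y - a *\<^sub>C y) \<le> norm (y - cnj a *\<^sub>C T y)"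
proof -
  have "Re (a * cinner y (T y)) = Re (cnj a * cinner (T y) y)"
    by (subst cinner_commute[of y]) simp
  then have "(norm (y - cnj a *\<^sub>C T y))\<^sup>2 - (norm (T y - a *\<^sub>C y))\<^sup>2
      = (1 - (cmod a)\<^sup>2) * ((norm y)\<^sup>2 - (norm (T y))\<^sup>2)"
    using norm_add_scaleC_sq[of "T y" "- a" y] norm_add_scaleC_sq[of y "- cnj a" "T y"]
    by (simp add: scaleC_minus_left algebra_simps)
  also have "\<dots> \<ge> 0"
    using assms by (intro mult_nonneg_nonneg) (simp_all add: power_le_one power_mono)
  finally show ?thesis
    by (simp flip: abs_le_square_iff)
qed

text \<open>Induction on \<open>n\<close>: splitting off a root \<open>a\<close> of \<open>q\<close>
  turns a factor \<open>T - a\<close> on the left into \<open>1 - cnj a T\<close> on the right. The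
  vector \<open>x\<close> varies in the induction because the remaining factors act on a different
  vector.\<close>

lemma norm_poly_op_le_conj_reflect:
  fixes T :: "'a::complex_inner \<Rightarrow> 'a"
  assumes T: "bounded_clinear T" and contr: "\<And>x. norm (T x) \<le> norm x"
    and "degree q \<le> n" "\<And>z. cmod z < 1 \<Longrightarrow> poly (conj_reflect n q) z \<noteq> 0"
  shows "norm (poly_op q T x) \<le> norm (poly_op (conj_reflect n q) T x)"
  using assms(3,4)
proof (induction n arbitrary: q x)
  case 0
  then obtain c where "q = [:c:]"
    using degree_eq_zeroE by auto
  then show ?case
    by (simp add: conj_reflect_def monom_0 poly_op_def norm_scaleC)
next
  case (Suc n)
  show ?case
  proof (cases "degree q = 0")
    case True
    then obtain c where "q = [:c:]"
      using degree_eq_zeroE by auto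
    \<comment> \<open>This case contradicts the hypothesis: the reflection has positive exponent
      \<open>Suc n\<close> and hence vanishes at 0.\<close>
    then have "conj_reflect (Suc n) q = monom (cnj c) (Suc n)"
      by (intro conj_reflect_unique) (simp_all add: poly_monom)
    then show ?thesis
      using Suc.prems(2)[of 0] by (simp add: poly_monom)
  next
    case False
    then obtain a where "poly q a = 0"
      using Fundamental_Theorem_Algebra.fundamental_theorem_of_algebra[of q] by (auto simp: constant_degree)
    then obtain q1 where q: "q = [:- a, 1:] * q1"
      by (auto simp: poly_eq_0_iff_dvd)
    have deg: "degree q1 \<le> n"
    proof -
      have "q1 \<noteq> 0" using False q by auto
      then have "degree q = Suc (degree q1)"
        unfolding q by (subst degree_mult_eq) auto
      then show ?thesis using Suc.prems(1) by simp
    qed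
    have refl: "conj_reflect (Suc n) q = [:1, - cnj a:] * conj_reflect n q1"
      unfolding q by (rule conj_reflect_linear_mult[OF deg])
    have a: "cmod a \<le> 1"
    proof (rule ccontr)
      assume "\<not> cmod a \<le> 1"
      \<comment> \<open>A root outside the closed disc would give the reflection the zero
        \<open>1 / cnj a\<close> inside the open disc.\<close>
      then have "cmod (1 / cnj a) < 1" "a \<noteq> 0"
        by (auto simp: norm_divide divide_less_eq_1)
      then show False
        using Suc.prems(2)[of "1 / cnj a"] by (simp add: refl)
    qed
    have nz: "poly (conj_reflect n q1) z \<noteq> 0" if "cmod z < 1" for z
      using Suc.prems(2)[OF that] by (auto simp: refl)
    define y where "y = poly_op q1 T x"
    have "norm (poly_op q T x) = norm (T y - a *\<^sub>C y)"
      unfolding q y_def poly_op_mult[OF T] poly_op_linear_poly[OF T]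
      by (simp add: scaleC_minus_left scaleC_one)
    also have "\<dots> \<le> norm (y - cnj a *\<^sub>C T y)"
      by (rule norm_Moebius_le[OF contr a])
    also have "\<dots> = norm (poly_op ([:1, - cnj a:] * q1) T x)"
      unfolding y_def poly_op_mult[OF T] poly_op_linear_poly[OF T]
      by (simp add: scaleC_minus_left scaleC_one)
    \<comment> \<open>Polynomials in \<open>T\<close> commute, so the induction hypothesis for
      \<open>q1\<close> can be used at the vector \<open>(1 - cnj a T) x\<close>.\<close>
    also have "\<dots> = norm (poly_op q1 T (poly_op [:1, - cnj a:] T x))"
      by (simp only: mult.commute[of _ q1] poly_op_mult[OF T])
    also have "\<dots> \<le> norm (poly_op (conj_reflect n q1) T (poly_op [:1, - cnj a:] T x))"
      by (rule Suc.IH[OF deg nz])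
    also have "\<dots> = norm (poly_op (conj_reflect (Suc n) q) T x)"
      by (simp only: refl mult.commute[of _ "conj_reflect n q1"] poly_op_mult[OF T])
    finally show ?thesis .
  qed
qed

text \<open>Maximum principle for \<open>h / g\<close>, which has no poles in the closed
  disc.\<close>

lemma poly_norm_le_disc:
  assumes nz: "\<And>z. cmod z \<le> 1 \<Longrightarrow> poly g z \<noteq> 0"
    and le: "\<And>z. cmod z = 1 \<Longrightarrow> cmod (poly h z) \<le> cmod (poly g z)"
    and z: "cmod z \<le> 1"
  shows "cmod (poly h z) \<le> cmod (poly g z)"
proof -
  have "cmod (poly h z / poly g z) \<le> 1"
  proof (rule maximum_modulus_frontier[where f = "\<lambda>z. poly h z / poly g z" and S = "cball 0 1" and \<xi> = z])
    show "(\<lambda>z. poly h z / poly g z) holomorphic_on interior (cball 0 1)"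
      using nz by (auto intro!: holomorphic_intros)
    show "continuous_on (closure (cball 0 1)) (\<lambda>z. poly h z / poly g z)"
      using nz by (auto intro!: continuous_intros)
  next
    fix w :: complex
    assume "w \<in> frontier (cball 0 1)"
    then show "cmod (poly h w / poly g w) \<le> 1"
      using le[of w] nz[of w] by (simp add: norm_divide)
  qed (use z in auto)
  then show ?thesis
    using nz[OF z] by (simp add: norm_divide)
qed

lemma norm_poly_op_le_strict_contraction:
  fixes T :: "'a::complex_inner \<Rightarrow> 'a"
  assumes T: "bounded_clinear T" and contr: "\<And>x. norm (T x) \<le> r * norm x" and r: "0 \<le> r" "r < 1"
    and nz: "\<And>z. cmod z \<le> 1 \<Longrightarrow> poly g z \<noteq> 0"
    and le: "\<And>z. cmod z = 1 \<Longrightarrow> cmod (poly p z) \<le> cmod (poly g z)"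
  shows "norm (poly_op p T x) \<le> norm (poly_op g T x)"
proof -
  \<comment> \<open>A common degree bound, so that reflecting with \<open>Suc m + n\<close> turns
    both terms of \<open>q\<close> below into the terms of \<open>q'\<close>.\<close>
  define n where "n = max (degree p) (degree g)"
  have degp: "degree p \<le> n" and degg: "degree g \<le> n"
    by (auto simp: n_def)
  define P G where "P = conj_reflect n p" and "G = conj_reflect n g"
  have PG: "cmod (poly P z) \<le> cmod (poly g z)" if "cmod z \<le> 1" for z
    by (rule poly_norm_le_disc[OF nz _ that])
      (simp_all add: P_def norm_poly_conj_reflect_circle degp le)
  have contr1: "norm (T y) \<le> norm y" for y
    using contr[of y] mult_right_mono[of r 1 "norm y"] r by simp
  have key: "norm (s *\<^sub>C poly_op p T x + (T ^^ Suc m) (poly_op G T x))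
      \<le> norm (poly_op g T x + s *\<^sub>C (T ^^ Suc m) (poly_op P T x))"
    if s: "s = 1 \<or> s = - 1" for s and m :: nat
  proof -
    define q where "q = smult s p + monom 1 (Suc m) * G"
    define q' where "q' = g + smult s (monom 1 (Suc m) * P)"
    have deg: "degree q \<le> Suc m + n"
      unfolding q_def
    proof (rule degree_add_le)
      show "degree (smult s p) \<le> Suc m + n"
        using degree_smult_le[of s p] degp by simp
      show "degree (monom 1 (Suc m) * G) \<le> Suc m + n"
        using degree_mult_le[of "monom 1 (Suc m)" G] degree_conj_reflect[of n g]
        by (simp add: G_def degree_monom_eq)
    qed
    have refl: "conj_reflect (Suc m + n) q = q'"
    proof (rule conj_reflect_unique[OF deg])
      fix z :: complex
      assume z: "z \<noteq> 0"
      have "cnj s = s" using s by auto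
      \<comment> \<open>For a fixed degree bound, reflection is an involution.\<close>
      have "poly g z = z ^ n * cnj (poly G (1 / cnj z))"
        using z by (simp add: G_def poly_conj_reflect degg power_divide)
      moreover have "poly P z = z ^ n * cnj (poly p (1 / cnj z))"
        using z by (simp add: P_def poly_conj_reflect degp)
      ultimately show "poly q' z = z ^ (Suc m + n) * cnj (poly q (1 / cnj z))"
        using z \<open>cnj s = s\<close> by (simp add: q_def q'_def poly_monom power_add power_divide field_simps)
    qed
    have "poly q' z \<noteq> 0" if z: "cmod z < 1" for z
    proof
      assume "poly q' z = 0"
      then have "poly g z = - (s * z ^ Suc m * poly P z)"
        by (simp add: q'_def poly_monom eq_neg_iff_add_eq_0 mult.assoc)
      then have "cmod (poly g z) = cmod z ^ Suc m * cmod (poly P z)"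
        using s by (auto simp: norm_mult norm_power)
      also have "\<dots> \<le> cmod z ^ Suc m * cmod (poly g z)"
        using z by (intro mult_left_mono PG) auto
      finally have "1 \<le> cmod z ^ Suc m"
        using nz[of z] z by simp
      \<comment> \<open>The exponent \<open>Suc m\<close> is positive for every \<open>m\<close>; a
        zeroth power would equal 1 and give no contradiction.\<close>
      moreover have "cmod z ^ Suc m < 1"
        using z power_Suc_le_self[of "cmod z" m] by simp
      ultimately show False by simp
    qed
    then have "norm (poly_op q T x) \<le> norm (poly_op q' T x)"
      using norm_poly_op_le_conj_reflect[OF T contr1 deg, of x] refl by simp
    then show ?thesis
      by (simp only: q_def q'_def poly_op_add poly_op_smult[OF T] poly_op_mult[OF T] poly_op_monom_one[OF T])
  qed
  have bound: "(norm (poly_op p T x))\<^sup>2 \<le>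
      (norm (poly_op g T x))\<^sup>2 + (norm ((T ^^ Suc m) (poly_op P T x)))\<^sup>2" for m
  proof -
    define u v w y where "u = poly_op p T x" and "v = (T ^^ Suc m) (poly_op G T x)"
      and "w = poly_op g T x" and "y = (T ^^ Suc m) (poly_op P T x)"
    have "norm (u + v) \<le> norm (w + y)"
      using key[of 1 m] by (simp add: u_def v_def w_def y_def scaleC_one)
    moreover have "norm (u - v) \<le> norm (w - y)"
      using key[of "- 1" m]
      by (simp add: u_def v_def w_def y_def scaleC_one scaleC_minus_left norm_minus_commute)
    ultimately have "(norm (u + v))\<^sup>2 + (norm (u - v))\<^sup>2 \<le> (norm (w + y))\<^sup>2 + (norm (w - y))\<^sup>2"
      by (intro add_mono power_mono) auto
    \<comment> \<open>Summing over both signs removes the mixed terms; afterwards the square of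
      \<open>norm v\<close> is dropped.\<close>
    then have "(norm u)\<^sup>2 + (norm v)\<^sup>2 \<le> (norm w)\<^sup>2 + (norm y)\<^sup>2"
      by (simp add: parallelogram)
    then show ?thesis
      unfolding u_def w_def y_def using zero_le_power2[of "norm v"] by linarith
  qed
  have pow: "norm ((T ^^ m) y) \<le> r ^ m * norm y" for m y
  proof (induction m)
    case (Suc m)
    have "norm ((T ^^ Suc m) y) \<le> r * norm ((T ^^ m) y)"
      using contr by simp
    also have "\<dots> \<le> r * (r ^ m * norm y)"
      by (intro mult_left_mono Suc r)
    finally show ?case by (simp add: mult.assoc)
  qed simp
  have "(\<lambda>m. r ^ m * norm (poly_op P T x)) \<longlonglongrightarrow> 0"
    using r by (intro tendsto_mult_left_zero LIMSEQ_power_zero) auto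
  then have "(\<lambda>m. (T ^^ m) (poly_op P T x)) \<longlonglongrightarrow> 0"
    by (rule Lim_null_comparison[rotated]) (simp add: pow)
  then have "(\<lambda>m. (T ^^ Suc m) (poly_op P T x)) \<longlonglongrightarrow> 0"
    by (rule LIMSEQ_Suc)
  then have "(\<lambda>m. (norm (poly_op g T x))\<^sup>2 + (norm ((T ^^ Suc m) (poly_op P T x)))\<^sup>2)
      \<longlonglongrightarrow> (norm (poly_op g T x))\<^sup>2 + (norm (0::'a))\<^sup>2"
    by (intro tendsto_intros)
  then have "(norm (poly_op p T x))\<^sup>2 \<le> (norm (poly_op g T x))\<^sup>2 + (norm (0::'a))\<^sup>2"
    by (rule Lim_bounded2) (use bound in auto)
  then show ?thesis
    by (simp flip: abs_le_square_iff)
qed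

text \<open>Comparing two vectors instead of bounding a quotient keeps inverses out, so the passage
  from \<open>rT\<close> to \<open>T\<close> only needs continuity of polynomials in
  \<open>r\<close>.\<close>

theorem von_Neumann_inequality:
  fixes T :: "'a::complex_inner \<Rightarrow> 'a"
  assumes T: "bounded_clinear T" and contr: "\<And>x. norm (T x) \<le> norm x"
    and nz: "\<And>z. cmod z \<le> 1 \<Longrightarrow> poly g z \<noteq> 0"
    and le: "\<And>z. cmod z = 1 \<Longrightarrow> cmod (poly p z) \<le> cmod (poly g z)"
  shows "norm (poly_op p T x) \<le> norm (poly_op g T x)"
proof (rule tendsto_le)
  define r where "r = (\<lambda>n. 1 - inverse (real (Suc n)))"
  have "r \<longlonglongrightarrow> 1 - 0"
    unfolding r_def by (intro tendsto_intros LIMSEQ_inverse_real_of_nat)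
  then have r: "r \<longlonglongrightarrow> 1" by simp
  show "(\<lambda>n. norm (poly_op p (\<lambda>x. r n *\<^sub>R T x) x)) \<longlonglongrightarrow> norm (poly_op p T x)"
    "(\<lambda>n. norm (poly_op g (\<lambda>x. r n *\<^sub>R T x) x)) \<longlonglongrightarrow> norm (poly_op g T x)"
    by (intro tendsto_norm tendsto_poly_op_scaleR[OF T r])+
  have "norm (poly_op p (\<lambda>x. r n *\<^sub>R T x) x) \<le> norm (poly_op g (\<lambda>x. r n *\<^sub>R T x) x)" for n
  proof (rule norm_poly_op_le_strict_contraction[OF bounded_clinear_scaleR[OF T] _ _ _ nz le])
    show r0: "0 \<le> r n"
      by (simp add: r_def field_simps)
    show "r n < 1"
      by (simp add: r_def)
    show "norm (r n *\<^sub>R T x) \<le> r n * norm x" for x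
      using r0 contr[of x] by (simp add: mult_left_mono)
  qed
  then show "\<forall>\<^sub>F n in sequentially. norm (poly_op p (\<lambda>x. r n *\<^sub>R T x) x)
      \<le> norm (poly_op g (\<lambda>x. r n *\<^sub>R T x) x)"
    by simp
qed simp

text \<open>If \<open>g\<close> vanishes at 0, the bound forces \<open>p\<close> to vanish there
  too. Cancelling \<open>z\<close> from both replaces \<open>x\<close> by \<open>T x\<close> and
  lowers the degree of \<open>g\<close>; once \<open>g\<close> is nonzero at 0 the inequality on the
  full disc applies.\<close>

lemma von_Neumann_inequality_punctured:
  fixes T :: "'a::complex_inner \<Rightarrow> 'a"
  assumes T: "bounded_clinear T" and contr: "\<And>x. norm (T x) \<le> norm x"
    and "\<And>z. z \<noteq> 0 \<Longrightarrow> cmod z \<le> 1 \<Longrightarrow> poly g z \<noteq> 0"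
    and "\<And>z. z \<noteq> 0 \<Longrightarrow> cmod z \<le> 1 \<Longrightarrow> cmod (poly p z) \<le> cmod (poly g z)"
  shows "norm (poly_op p T x) \<le> norm (poly_op g T x)"
  using assms(3,4)
proof (induction "degree g" arbitrary: p g x rule: less_induct)
  case less
  show ?case
  proof (cases "poly g 0 = 0")
    case False
    have "poly g z \<noteq> 0" if "cmod z \<le> 1" for z
      using False less.prems(1)[OF _ that] by blast
    moreover have "cmod (poly p z) \<le> cmod (poly g z)" if "cmod z = 1" for z
      using less.prems(2)[of z] that by force
    ultimately show ?thesis
      by (rule von_Neumann_inequality[OF T contr])
  next
    case True
    \<comment> \<open>The bound extends across the puncture by continuity.\<close>
    have "cmod (poly p 0) \<le> cmod (poly g 0)"
    proof (rule tendsto_le)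
      show "((\<lambda>z. cmod (poly p z)) \<longlongrightarrow> cmod (poly p 0)) (at 0)"
        "((\<lambda>z. cmod (poly g z)) \<longlongrightarrow> cmod (poly g 0)) (at 0)"
        by (intro tendsto_intros isContD poly_isCont)+
      show "\<forall>\<^sub>F z in at 0. cmod (poly p z) \<le> cmod (poly g z)"
        unfolding eventually_at
        by (rule exI[of _ 1]) (auto intro!: less.prems(2) simp: dist_norm)
    qed simp
    then have "poly p 0 = 0" using True by simp
    then obtain p1 where p: "p = pCons 0 p1"
      by (cases p) auto
    obtain g1 where g: "g = pCons 0 g1"
      using True by (cases g) auto
    have "g \<noteq> 0"
      using less.prems(1)[of 1] by auto
    then have "g1 \<noteq> 0"
      using g by auto
    have "norm (poly_op p1 T (T x)) \<le> norm (poly_op g1 T (T x))"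
    proof (rule less.hyps)
      show "degree g1 < degree g"
        using \<open>g1 \<noteq> 0\<close> g by simp
      show "poly g1 z \<noteq> 0" if "z \<noteq> 0" "cmod z \<le> 1" for z
        using less.prems(1)[OF that] by (simp add: g)
      show "cmod (poly p1 z) \<le> cmod (poly g1 z)" if "z \<noteq> 0" "cmod z \<le> 1" for z
        using less.prems(2)[OF that] that by (simp add: g p norm_mult)
    qed
    moreover have "poly_op (pCons 0 q) T x = poly_op q T (T x)" for q
    proof -
      have "pCons 0 q = q * [:0, 1:]" by simp
      then show ?thesis
        by (simp only: poly_op_mult[OF T] poly_op_linear_poly[OF T]) (simp add: scaleC_one)
    qed
    ultimately show ?thesis
      by (simp add: p g)
  qed
qed

section \<open>Spectrum and functional calculus\<close>

text \<open>Every root \<open>a\<close> of \<open>g\<close> lies off the spectrum, so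
  \<open>g(T)\<close> is a composition of surjective factors \<open>T - a\<close> and a nonzero
  scalar. Surjectivity makes \<open>inv\<close> a right inverse of \<open>g(T)\<close>.\<close>

lemma surj_poly_op:
  fixes T :: "'a::complex_inner \<Rightarrow> 'a"
  assumes T: "bounded_clinear T" and "g \<noteq> 0" "\<And>z. z \<in> spectrum T \<Longrightarrow> poly g z \<noteq> 0"
  shows "surj (poly_op g T)"
  using assms(2,3)
proof (induction "degree g" arbitrary: g)
  case 0
  then obtain c where "g = [:c:]" "c \<noteq> 0"
    using degree_eq_zeroE by (metis pCons_0_0)
  then have "poly_op g T (inverse c *\<^sub>C y) = y" for y
    by (simp add: poly_op_def scaleC_scaleC scaleC_one)
  then show ?case
    by (metis surjI)
next
  case (Suc n)
  then obtain a where "poly g a = 0"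
    using Fundamental_Theorem_Algebra.fundamental_theorem_of_algebra[of g] by (auto simp: constant_degree)
  then obtain g1 where g: "g = [:- a, 1:] * g1"
    by (auto simp: poly_eq_0_iff_dvd)
  have "a \<notin> spectrum T"
    using Suc.prems(2) \<open>poly g a = 0\<close> by blast
  then obtain S where S: "(\<lambda>x. T x - a *\<^sub>C x) \<circ> S = id"
    by (auto simp: spectrum_def invertible_op_def)
  have "g1 \<noteq> 0" using Suc.prems(1) g by auto
  then have "degree g = Suc (degree g1)"
    unfolding g by (subst degree_mult_eq) auto
  then have surj: "surj (poly_op g1 T)"
    using Suc g \<open>g1 \<noteq> 0\<close> by auto
  have "poly_op g T = (\<lambda>x. T x - a *\<^sub>C x) \<circ> poly_op g1 T"
    unfolding g by (rule ext)
      (simp only: poly_op_mult[OF T] poly_op_linear_poly[OF T] o_apply scaleC_minus_left scaleC_one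
        uminus_add_conv_diff)
  moreover have "surj (\<lambda>x. T x - a *\<^sub>C x)"
    using S by (metis comp_apply id_apply surjI)
  ultimately show ?case
    using surj comp_surj by metis
qed

text \<open>For \<open>cmod z > 1\<close> the operator \<open>T - z\<close> is bounded below by
  \<open>cmod z - 1\<close>, which gives injectivity and a bounded inverse; surjectivity comes from
  a fixed point argument.\<close>

lemma spectrum_contraction_subset:
  fixes T :: "'a::chilbert_space \<Rightarrow> 'a"
  assumes T: "bounded_clinear T" and contr: "\<And>x. norm (T x) \<le> norm x"
  shows "spectrum T \<subseteq> cball 0 1"
proof
  fix z
  assume "z \<in> spectrum T"
  show "z \<in> cball 0 1"
  proof (rule ccontr)
    assume "z \<notin> cball 0 1"
    then have z: "cmod z > 1" by simp
    then have "z \<noteq> 0" by auto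
    define A where "A = (\<lambda>x. T x - z *\<^sub>C x)"
    have lin: "linear T"
      by (rule bounded_linear.linear[OF bounded_clinearD(1)[OF T]])
    have A_add: "A (x + y) = A x + A y" for x y
      by (simp add: A_def linear_add[OF lin] scaleC_add_right)
    have A_scaleC: "A (c *\<^sub>C x) = c *\<^sub>C A x" for c x
      by (simp add: A_def bounded_clinearD(2)[OF T] scaleC_diff_right scaleC_scaleC mult.commute)
    have A_scaleR: "A (c *\<^sub>R x) = c *\<^sub>R A x" for c x
      by (simp add: scaleR_scaleC A_scaleC)
    have below: "(cmod z - 1) * norm x \<le> norm (A x)" for x
      using contr[of x] norm_triangle_ineq2[of "z *\<^sub>C x" "T x"]
      by (simp add: A_def norm_scaleC norm_minus_commute algebra_simps)
    have inj: "inj A"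
    proof (rule injI)
      fix x y
      assume "A x = A y"
      then have "A (x - y) = 0"
        using A_add[of "x - y" y] by simp
      then show "x = y"
        using below[of "x - y"] z by (simp add: mult_le_0_iff)
    qed
    have "surj A"
      unfolding surj_def
    proof
      fix y
      \<comment> \<open>The fixed point equation is \<open>T x - z x = y\<close> rearranged. Its
        Lipschitz constant is \<open>inverse (cmod z)\<close>, and completeness of the space enters
        here.\<close>
      have "\<exists>!x. inverse z *\<^sub>C (T x - y) = x"
      proof (rule banach_fix_type)
        show "0 \<le> inverse (cmod z)" "inverse (cmod z) < 1"
          using z by (auto simp: inverse_less_1_iff)
        have "dist (inverse z *\<^sub>C (T x - y)) (inverse z *\<^sub>C (T x' - y))
            = inverse (cmod z) * norm (T (x - x'))" for x x'
          by (simp add: dist_norm scaleC_diff_right[symmetric] norm_scaleC norm_inverse linear_diff[OF lin])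
        then show "\<forall>x x'. dist (inverse z *\<^sub>C (T x - y)) (inverse z *\<^sub>C (T x' - y))
            \<le> inverse (cmod z) * dist x x'"
          by (simp add: contr dist_norm mult_left_mono)
      qed
      then obtain x where "inverse z *\<^sub>C (T x - y) = x"
        by blast
      then have "T x - y = z *\<^sub>C x"
        using \<open>z \<noteq> 0\<close> by (metis right_inverse scaleC_one scaleC_scaleC)
      then have "y = A x"
        by (simp add: A_def algebra_simps)
      then show "\<exists>x. y = A x" ..
    qed
    define S where "S = inv A"
    have SA: "S (A x) = x" for x
      using inj by (simp add: S_def)
    have AS: "A (S y) = y" for y
      using \<open>surj A\<close> by (simp add: S_def surj_f_inv_f)
    have "bounded_linear S"
    proof (rule bounded_linear_intro[where K = "inverse (cmod z - 1)"])
      show "S (x + y) = S x + S y" for x y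
        by (metis A_add AS SA)
      show "S (c *\<^sub>R x) = c *\<^sub>R S x" for c x
        by (metis A_scaleR AS SA)
      show "norm (S x) \<le> norm x * inverse (cmod z - 1)" for x
        using below[of "S x"] z by (simp add: AS field_simps)
    qed
    moreover have "S (c *\<^sub>C x) = c *\<^sub>C S x" for c x
      by (metis A_scaleC AS SA)
    ultimately have "bounded_clinear S"
      by (simp add: bounded_clinear_def)
    moreover have "bounded_linear A"
    proof (rule bounded_linear_intro[where K = "1 + cmod z"])
      show "norm (A x) \<le> norm x * (1 + cmod z)" for x
        using contr[of x] norm_triangle_ineq4[of "T x" "z *\<^sub>C x"]
        by (simp add: A_def norm_scaleC algebra_simps)
    qed (fact A_add A_scaleR)+
    ultimately have "invertible_op A"
      unfolding invertible_op_def bounded_clinear_def[of A]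
      using A_scaleC SA AS by (auto simp: fun_eq_iff)
    then show False
      using \<open>z \<in> spectrum T\<close> by (simp add: spectrum_def A_def)
  qed
qed

lemma contraction_norm_le:
  assumes "contraction T"
  shows "norm (T x) \<le> norm x"
  using assms onorm[of T x] mult_right_mono[of "onorm T" 1 "norm x"]
  by (fastforce simp: contraction_def bounded_clinear_def)

lemma invertible_op_iff_spectrum: "invertible_op T \<longleftrightarrow> 0 \<notin> spectrum T"
  by (simp add: spectrum_def)

section \<open>The two implications of the equivalence\<close>

lemma invertible_contraction_imp_von_Neumann_set:
  fixes T :: "'a::chilbert_space \<Rightarrow> 'a"
  assumes T: "bounded_clinear T" and "invertible_op T" "contraction T"
  shows "von_Neumann_set (cball 0 1 - {0}) T"
proof -
  let ?Y = "cball 0 1 - {0} :: complex set"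
  note contr = contraction_norm_le[OF \<open>contraction T\<close>]
  have spec: "spectrum T \<subseteq> ?Y"
    using spectrum_contraction_subset[OF T contr] assms(2) by (auto simp: invertible_op_iff_spectrum)
  moreover have "ennreal (onorm (rat_op p g T)) \<le> rat_sup_norm ?Y p g" if "(p, g) \<in> Rat ?Y" for p g
  \<comment> \<open>An infinite supremum makes the bound trivial; a finite one is a real number
    \<open>S\<close>.\<close>
  proof (cases "rat_sup_norm ?Y p g" rule: ennreal_cases)
    case (real S)
    have g: "g \<noteq> 0" "\<And>z. z \<in> ?Y \<Longrightarrow> poly g z \<noteq> 0"
      using that by (auto simp: Rat_def)
    have quot: "cmod (poly p z) \<le> S * cmod (poly g z)" if "z \<in> ?Y" for z
    proof -
      have "ennreal (cmod (poly p z / poly g z)) \<le> ennreal S"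
        using that unfolding real(2)[symmetric] rat_sup_norm_def by (rule SUP_upper)
      then show ?thesis
        using real(1) g(2)[OF that] by (simp add: norm_divide field_simps)
    qed
    have le: "norm (poly_op p T x) \<le> S * norm (poly_op g T x)" for x
    proof -
      \<comment> \<open>\<open>S\<close> may be 0, and then \<open>S * g\<close> would have zeros in
        the punctured disc. A constant \<open>C > S\<close> is positive, and \<open>C\<close> then
        decreases to \<open>S\<close>.\<close>
      have "norm (poly_op p T x) \<le> C * norm (poly_op g T x)" if "S < C" for C
      proof -
        have C: "0 < C" using that real(1) by simp
        have "norm (poly_op p T x) \<le> norm (poly_op (smult (complex_of_real C) g) T x)"
        proof (rule von_Neumann_inequality_punctured[OF T contr])
          fix z :: complex
          assume z: "z \<noteq> 0" "cmod z \<le> 1"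
          then show "poly (smult (complex_of_real C) g) z \<noteq> 0"
            using g(2)[of z] C by simp
          show "cmod (poly p z) \<le> cmod (poly (smult (complex_of_real C) g) z)"
            using quot[of z] z C mult_right_mono[of S C "cmod (poly g z)"] that
            by (simp add: norm_mult)
        qed
        then show ?thesis
          using C by (simp add: poly_op_smult[OF T] norm_scaleC)
      qed
      then have "\<forall>\<^sub>F C in at_right S. norm (poly_op p T x) \<le> C * norm (poly_op g T x)"
        by (auto simp: eventually_at_filter)
      then show ?thesis
        by (rule tendsto_lowerbound[rotated]) (auto intro!: tendsto_intros)
    qed
    have "surj (poly_op g T)"
      using surj_poly_op[OF T g(1)] g(2) spec by blast
    \<comment> \<open>The vector inequality is taken at a preimage of \<open>y\<close> under
      \<open>g(T)\<close>.\<close>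
    then have "norm (rat_op p g T y) \<le> S * norm y" for y
      using le[of "inv (poly_op g T) y"] by (simp add: rat_op_def surj_f_inv_f)
    then have "onorm (rat_op p g T) \<le> S"
      using real(1) by (rule onorm_bound[rotated])
    then show ?thesis
      by (simp add: real ennreal_leI)
  qed simp
  ultimately show ?thesis
    by (auto simp: von_Neumann_set_def)
qed

text \<open>Invertibility holds because the spectrum avoids 0; the norm bound comes from the test
  function \<open>z\<close>, represented as \<open>[:0, 1:]\<close> over 1.\<close>

lemma von_Neumann_set_imp_invertible_contraction:
  fixes T :: "'a::chilbert_space \<Rightarrow> 'a"
  assumes T: "bounded_clinear T" and vN: "von_Neumann_set (cball 0 1 - {0}) T"
  shows "invertible_op T \<and> contraction T"
proof
  let ?Y = "cball 0 1 - {0} :: complex set"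
  show "invertible_op T"
    using vN by (auto simp: von_Neumann_set_def invertible_op_iff_spectrum)
  have "([:0, 1:], 1) \<in> Rat ?Y"
    by (simp add: Rat_def)
  then have "ennreal (onorm (rat_op [:0, 1:] 1 T)) \<le> rat_sup_norm ?Y [:0, 1:] 1"
    using vN by (auto simp: von_Neumann_set_def)
  moreover have "rat_op [:0, 1:] 1 T = T"
  proof -
    have "poly_op 1 T = id"
      by (simp add: poly_op_def scaleC_one fun_eq_iff)
    moreover have "poly_op [:0, 1:] T = T"
      by (simp add: poly_op_linear_poly[OF T] scaleC_one fun_eq_iff)
    ultimately show ?thesis
      by (simp add: rat_op_def)
  qed
  moreover have "rat_sup_norm ?Y [:0, 1:] 1 \<le> 1"
    unfolding rat_sup_norm_def by (rule SUP_least) simp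
  ultimately have "ennreal (onorm T) \<le> 1"
    by (metis order_trans)
  then show "contraction T"
    using T by (simp add: contraction_def)
qed

theorem lemma5p12:
  fixes T :: "'a::chilbert_space \<Rightarrow> 'a"
  assumes "bounded_clinear T"
  shows "invertible_op T \<and> contraction T \<longleftrightarrow> von_Neumann_set (cball 0 1 - {0}) T"
  using invertible_contraction_imp_von_Neumann_set[OF assms]
    von_Neumann_set_imp_invertible_contraction[OF assms] by blast

end
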